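(* Let $X$ be a graph as in the context, $M\in\{A,L,Q\}$, and let $u,v$ be twin vertices of $X$ with associated eigenvalue $\theta$. Then proper fractional revival occurs between $u$ and $v$ (with respect to $M$) if and only if all of the following hold: $u$ and $v$ are strongly cospectral; $\sigma_{uv}^+(M)$ satisfies the ratio condition; and there exist $\lambda_1>\lambda_2$ in $\sigma_{uv}^+(M)$ such that, enumerating $\sigma_{uv}^+(M)=\{\lambda_1,\lambda_2,\ldots,\lambda_r\}$ and defining $q$ as in the context with respect to this enumeration, the number $q\left(\frac{\lambda_1-\theta}{\lambda_1-\lambda_2}\right)$ is not an integer.
   Context: $X$ is a connected weighted undirected graph, possibly with loops but without multiple edges, with nonzero real edge weights; $\omega_{a,b}$ is the weight of edge $(a,b)$ ($0$ if absent). $A$ is the adjacency matrix, $D$ the diagonal degree matrix with $\deg(a)=2\omega_{a,a}+\sum_{b\neq a}\omega_{a,b}$, $L=D-A$, $Q=D+A$. $U(t)=e^{itM}$; $M=\sum_j\lambda_jE_j$ is the spectral decomposition into distinct eigenvalues and orthogonal projections. $\mathbf e_a$ is the standard basis vector of $a$. Twins: distinct $u,v$ with $N(u)\setminus\{u,v\}=N(v)\setminus\{u,v\}$, $\omega_{u,w}=\omega_{v,w}$ for all such $w$, and $\omega_{u,u}=\omega_{v,v}$. With $\omega=\omega_{u,u}$, $\eta=\omega_{u,v}$: $\theta=\omega-\eta$ ($M=A$), $\theta=\deg(u)-\omega+\eta$ ($M=L$), $\theta=\deg(u)+\omega-\eta$ ($M=Q$); $\mathbf e_u-\mathbf e_v$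 is a $\theta$-eigenvector. $u,v$ are strongly cospectral if $E_j\mathbf e_u=\pm E_j\mathbf e_v$ for all $j$; $\sigma_{uv}^+(M)=\{\lambda_j:E_j\mathbf e_u=E_j\mathbf e_v\neq0\}$, $\sigma_{uv}^-(M)=\{\lambda_j:E_j\mathbf e_u=-E_j\mathbf e_v\neq0\}$. A set $S$ of reals with at least two elements satisfies the ratio condition if $\frac{\lambda_p-\lambda_q}{\lambda_j-\lambda_k}\in\mathbb Q$ for all $\lambda_p,\lambda_q,\lambda_j,\lambda_k\in S$ with $\lambda_j\neq\lambda_k$. Given an enumeration $\{\lambda_1,\ldots,\lambda_r\}$ of a set satisfying the ratio condition with $\lambda_1>\lambda_2$, for $j=2,\ldots,r$ write $\frac{\lambda_1-\lambda_j}{\lambda_1-\lambda_2}=\frac{p_j}{q_j}$ with integers $p_j,q_j$, $q_j>0$, $\gcd(p_j,q_j)=1$, and put $q=\operatorname{lcm}(q_2,\ldots,q_r)$. $(\alpha,\beta)$-fractional revival occurs from $u$ to $v$ at time $\tau$ if $U(\tau)\mathbf e_u=\alpha\mathbf e_u+\beta\mathbf e_v$; proper if $\beta\neq0$; "between $u$ and $v$" means from $u$ to $v$.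
   Formalization: The graph is assumed to have at least three vertices: on two vertices proper fractional revival always occurs between the twins, but σ⁺ has a single element, so the ratio condition and the existence of λ₁ > λ₂ fail and the equivalence is false. *)

theory Defs
  imports "HOL-Analysis.Analysis"
begin

text \<open>
  A finite weighted graph on the vertex type \<open>'v\<close> is given by its weight function \<open>w\<close>. Edge
  weights are nonzero and absent edges have weight \<open>0\<close>, so \<open>a\<close> and \<open>b\<close> are adjacent iff
  \<open>w a b \<noteq> 0\<close>; in particular \<open>w a a \<noteq> 0\<close> means that there is a loop at \<open>a\<close>, and then \<open>a\<close> is one
  of its own neighbours.
\<close>

definition undirected :: "('v \<Rightarrow> 'v \<Rightarrow> real) \<Rightarrow> bool" where
  "undirected w \<longleftrightarrow> (\<forall>a b. w a b = w b a)"

definition connected_graph :: "('v \<Rightarrow> 'v \<Rightarrow> real) \<Rightarrow> bool" where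
  "connected_graph w \<longleftrightarrow> (\<forall>a b. (\<lambda>x y. w x y \<noteq> 0)\<^sup>*\<^sup>* a b)"

definition nbhd :: "('v \<Rightarrow> 'v \<Rightarrow> real) \<Rightarrow> 'v \<Rightarrow> 'v set" where
  "nbhd w a = {b. w a b \<noteq> 0}"

definition twins :: "('v \<Rightarrow> 'v \<Rightarrow> real) \<Rightarrow> 'v \<Rightarrow> 'v \<Rightarrow> bool" where
  "twins w u v \<longleftrightarrow> u \<noteq> v \<and>
     nbhd w u - {u, v} = nbhd w v - {u, v} \<and>
     (\<forall>x \<in> nbhd w u - {u, v}. w u x = w v x) \<and>
     w u u = w v v"

definition wdeg :: "('v::finite \<Rightarrow> 'v \<Rightarrow> real) \<Rightarrow> 'v \<Rightarrow> real" where
  "wdeg w a = 2 * w a a + (\<Sum>b \<in> UNIV - {a}. w a b)"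

definition adjacency_matrix :: "('v::finite \<Rightarrow> 'v \<Rightarrow> real) \<Rightarrow> real^'v^'v" where
  "adjacency_matrix w = (\<chi> a b. w a b)"

definition degree_matrix :: "('v::finite \<Rightarrow> 'v \<Rightarrow> real) \<Rightarrow> real^'v^'v" where
  "degree_matrix w = (\<chi> a b. if a = b then wdeg w a else 0)"

definition laplacian_matrix :: "('v::finite \<Rightarrow> 'v \<Rightarrow> real) \<Rightarrow> real^'v^'v" where
  "laplacian_matrix w = degree_matrix w - adjacency_matrix w"

definition signless_laplacian_matrix :: "('v::finite \<Rightarrow> 'v \<Rightarrow> real) \<Rightarrow> real^'v^'v" where
  "signless_laplacian_matrix w = degree_matrix w + adjacency_matrix w"

definition eigenspace :: "real^'v^'v \<Rightarrow> real \<Rightarrow> (real^'v::finite) set" where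
  "eigenspace M l = {x. M *v x = l *\<^sub>R x}"

definition eigenvalues :: "real^'v^'v::finite \<Rightarrow> real set" where
  "eigenvalues M = {l. \<exists>x \<in> eigenspace M l. x \<noteq> 0}"

definition orthogonal_projection :: "'a::real_inner set \<Rightarrow> 'a \<Rightarrow> 'a" where
  "orthogonal_projection S x = (THE y. y \<in> S \<and> (\<forall>z \<in> S. orthogonal (x - y) z))"

text \<open>
  For symmetric \<open>M\<close> and an eigenvalue \<open>l\<close>, this is the spectral projection \<open>E\<^sub>j\<close> belonging to
  \<open>\<lambda>\<^sub>j = l\<close> in \<open>M = (\<Sum>j. \<lambda>\<^sub>j E\<^sub>j)\<close>.
\<close>
definition eigenprojection :: "real^'v^'v \<Rightarrow> real \<Rightarrow> real^'v^'v::finite" where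
  "eigenprojection M l = matrix (orthogonal_projection (eigenspace M l))"

definition strongly_cospectral :: "real^'v^'v \<Rightarrow> 'v::finite \<Rightarrow> 'v \<Rightarrow> bool" where
  "strongly_cospectral M u v \<longleftrightarrow>
     (\<forall>l \<in> eigenvalues M.
        eigenprojection M l *v axis u 1 = eigenprojection M l *v axis v 1 \<or>
        eigenprojection M l *v axis u 1 = - (eigenprojection M l *v axis v 1))"

definition sigma_plus :: "real^'v^'v \<Rightarrow> 'v::finite \<Rightarrow> 'v \<Rightarrow> real set" where
  "sigma_plus M u v =
     {l \<in> eigenvalues M.
        eigenprojection M l *v axis u 1 = eigenprojection M l *v axis v 1 \<and>
        eigenprojection M l *v axis u 1 \<noteq> 0}"

definition ratio_condition :: "real set \<Rightarrow> bool" where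
  "ratio_condition S \<longleftrightarrow>
     (\<exists>x \<in> S. \<exists>y \<in> S. x \<noteq> y) \<and>
     (\<forall>p \<in> S. \<forall>q \<in> S. \<forall>j \<in> S. \<forall>k \<in> S. j \<noteq> k \<longrightarrow> (p - q) / (j - k) \<in> \<rat>)"

definition reduced_denominator :: "real \<Rightarrow> int" where
  "reduced_denominator x =
     (THE d. d > 0 \<and> (\<exists>n. coprime n d \<and> x = real_of_int n / real_of_int d))"

text \<open>
  The number \<open>q = lcm(q\<^sub>2, \<dots>, q\<^sub>r)\<close> for an enumeration of \<open>S\<close> starting with \<open>l1, l2\<close>; the order of
  the remaining elements does not matter. It is meaningful only if \<open>S\<close> is finite and satisfies
  the ratio condition.
\<close>
definition ratio_lcm :: "real set \<Rightarrow> real \<Rightarrow> real \<Rightarrow> int" where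
  "ratio_lcm S l1 l2 = Lcm ((\<lambda>l. reduced_denominator ((l1 - l) / (l1 - l2))) ` (S - {l1}))"

text \<open>
  The multiplication of the type class on vectors is componentwise, so neither the library's
  powers nor \<open>exp\<close> give the matrix exponential; it is defined by its power series.
\<close>
definition matrix_exp :: "complex^'v^'v \<Rightarrow> complex^'v^'v::finite" where
  "matrix_exp N = (\<Sum>k. (1 / fact k) *\<^sub>R ((\<lambda>P. N ** P) ^^ k) (mat 1))"

definition transition_matrix :: "real^'v^'v \<Rightarrow> real \<Rightarrow> complex^'v^'v::finite" where
  "transition_matrix M t = matrix_exp (map_matrix (\<lambda>x. \<i> * complex_of_real t * complex_of_real x) M)"

definition fractional_revival ::
    "real^'v^'v \<Rightarrow> 'v::finite \<Rightarrow> 'v \<Rightarrow> complex \<Rightarrow> complex \<Rightarrow> real \<Rightarrow> bool" where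
  "fractional_revival M u v \<alpha> \<beta> \<tau> \<longleftrightarrow>
     transition_matrix M \<tau> *v axis u 1 = \<alpha> *s axis u 1 + \<beta> *s axis v 1"

definition proper_fractional_revival :: "real^'v^'v \<Rightarrow> 'v::finite \<Rightarrow> 'v \<Rightarrow> bool" where
  "proper_fractional_revival M u v \<longleftrightarrow> (\<exists>\<tau> \<alpha> \<beta>. \<beta> \<noteq> 0 \<and> fractional_revival M u v \<alpha> \<beta> \<tau>)"

end

theory Submission
  imports Defs
begin

text \<open>
  Eigenvectors \<open>z\<close> of the symmetric matrix \<open>M\<close> span the space, so revival at time \<open>\<tau>\<close> can be tested
  against them: it says \<open>cis (\<tau> l) z\<^sub>u = \<alpha> z\<^sub>u + \<beta> z\<^sub>v\<close> whenever \<open>M z = l z\<close>. Since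
  \<open>e\<^sub>u - e\<^sub>v\<close> is a \<open>\<theta>\<close>-eigenvector, orthogonality gives \<open>z\<^sub>u = z\<^sub>v\<close> for \<open>l \<noteq> \<theta>\<close>, and proper revival
  forces \<open>z\<^sub>u = - z\<^sub>v\<close> for \<open>l = \<theta>\<close>, which is strong cospectrality. What remains is the existence of
  a \<open>\<tau>\<close> for which \<open>cis (\<tau> l)\<close> is constant on \<open>\<sigma>\<^sup>+\<close> but takes another value at \<open>\<theta>\<close>. The times with
  constant value on \<open>\<sigma>\<^sup>+\<close> are the integer multiples of \<open>2 \<pi> q / (\<lambda>\<^sub>1 - \<lambda>\<^sub>2)\<close>. Finally, \<open>\<sigma>\<^sup>+\<close> has
  two elements, since otherwise \<open>e\<^sub>u + e\<^sub>v\<close> would be an eigenvector and no third vertex could be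
  joined to \<open>{u, v}\<close>.
\<close>

subsection \<open>Spectral theorem for symmetric matrices\<close>

lemma symmetric_matrix_inner:
  fixes M :: "real^'n^'n"
  assumes "transpose M = M"
  shows "(M *v x) \<bullet> y = x \<bullet> (M *v y)"
  by (metis assms dot_lmul_matrix transpose_matrix_vector)

lemma subspace_eigenspace: "subspace (eigenspace M l)"
  unfolding subspace_def eigenspace_def
  by (auto simp: matrix_vector_right_distrib scaleR_right_distrib matrix_vector_mult_scaleR)

lemma symmetric_eigenspaces_orthogonal:
  fixes M :: "real^'n^'n"
  assumes "transpose M = M" "x \<in> eigenspace M l" "y \<in> eigenspace M m" "l \<noteq> m"
  shows "x \<bullet> y = 0"
proof -
  have "l * (x \<bullet> y) = (M *v x) \<bullet> y"
    using assms(2) by (simp add: eigenspace_def)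
  also have "\<dots> = m * (x \<bullet> y)"
    using assms(1,3) by (simp add: symmetric_matrix_inner eigenspace_def)
  finally show ?thesis
    using \<open>l \<noteq> m\<close> by simp
qed

text \<open>First-order condition at an extremum: for \<open>t\<close> a small negative multiple of
  \<open>c\<close> the linear term outweighs the quadratic one, so a positive \<open>c\<close> would
  make the expression negative.\<close>

lemma nonneg_quadratic_imp_linear_coeff_0:
  fixes b c :: real
  assumes "c \<ge> 0" "\<And>t. 2 * t * c + t\<^sup>2 * b \<ge> 0"
  shows "c = 0"
proof (rule ccontr)
  assume "c \<noteq> 0"
  \<comment> \<open>The factor \<open>s\<close> is small enough that \<open>s * b < 2\<close>, which
    makes the value at \<open>t = - s * c\<close> negative.\<close>
  define s where "s = 1 / (\<bar>b\<bar> + 1)"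
  have s: "s > 0" "s * \<bar>b\<bar> < 1"
    by (auto simp: s_def field_simps)
  have "s * b < 2"
    using s by (smt (verit) mult_left_mono abs_ge_self)
  moreover have "2 * (- s * c) * c + (- s * c)\<^sup>2 * b = s * c\<^sup>2 * (s * b - 2)"
    by (simp add: power2_eq_square algebra_simps)
  moreover have "s * c\<^sup>2 > 0"
    using s \<open>c \<noteq> 0\<close> by simp
  ultimately show False
    using assms(2)[of "- s * c"] by (simp add: zero_le_mult_iff)
qed

text \<open>A maximiser of the quadratic form on the unit sphere of the subspace is an eigenvector.\<close>
lemma symmetric_invariant_subspace_eigenvector:
  fixes M :: "real^'n^'n"
  assumes sym: "transpose M = M" and S: "subspace S" "\<And>x. x \<in> S \<Longrightarrow> M *v x \<in> S"
    and "a \<in> S" "a \<noteq> 0"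
  obtains l z where "z \<in> S" "z \<noteq> 0" "z \<in> eigenspace M l"
proof -
  define f where "f = (\<lambda>x. x \<bullet> (M *v x))"
  have "compact (sphere 0 1 \<inter> S)"
    by (intro compact_Int_closed compact_sphere closed_subspace S)
  moreover have "(1 / norm a) *\<^sub>R a \<in> sphere 0 1 \<inter> S"
    using assms by (simp add: subspace_scale)
  moreover have "continuous_on (sphere 0 1 \<inter> S) f"
    unfolding f_def by (intro continuous_intros linear_continuous_on) (simp add: linear_linear)
  ultimately obtain x where x: "norm x = 1" "x \<in> S"
    and max: "\<And>y. norm y = 1 \<Longrightarrow> y \<in> S \<Longrightarrow> f y \<le> f x"
    using continuous_attains_sup[of "sphere 0 1 \<inter> S" f] by (smt (verit) Int_iff empty_iff mem_sphere_0)
  \<comment> \<open>Homogeneity carries the bound from the unit sphere to all of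
    \<open>S\<close>.\<close>
  have form: "f y \<le> f x * (y \<bullet> y)" if "y \<in> S" for y
  proof (cases "y = 0")
    case False
    have "f ((1 / norm y) *\<^sub>R y) \<le> f x"
      using False that S by (intro max) (auto simp: subspace_scale)
    then show ?thesis
      using False
      by (simp add: f_def matrix_vector_mult_scaleR dot_square_norm field_simps power2_eq_square)
  qed (simp add: f_def)
  \<comment> \<open>The residual of the eigenvector equation at \<open>x\<close>. Perturbing
    \<open>x\<close> to \<open>x + t *\<^sub>R y\<close> produces the linear term
    \<open>2 * t * (y \<bullet> y)\<close>, which maximality forces to vanish.\<close>
  define y where "y = f x *\<^sub>R x - M *v x"
  have y: "y \<in> S"
    unfolding y_def using x S by (intro subspace_diff subspace_scale) auto
  have "y \<bullet> y = 0"
  proof (rule nonneg_quadratic_imp_linear_coeff_0)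
    fix t :: real
    have "f (x + t *\<^sub>R y) \<le> f x * ((x + t *\<^sub>R y) \<bullet> (x + t *\<^sub>R y))"
      using x y S by (intro form subspace_add subspace_scale) auto
    moreover have "f (x + t *\<^sub>R y) = f x + 2 * t * ((M *v x) \<bullet> y) + t\<^sup>2 * f y"
      using symmetric_matrix_inner[OF sym, of x y] inner_commute[of "M *v x" y]
      by (simp add: f_def matrix_vector_right_distrib matrix_vector_mult_scaleR inner_add_left
          inner_add_right power2_eq_square algebra_simps)
    moreover have "(x + t *\<^sub>R y) \<bullet> (x + t *\<^sub>R y) = 1 + 2 * t * (x \<bullet> y) + t\<^sup>2 * (y \<bullet> y)"
      using x(1) inner_commute[of x y]
      by (simp add: inner_add_left inner_add_right power2_eq_square algebra_simps norm_eq_1)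
    ultimately have "f x + 2 * t * ((M *v x) \<bullet> y) + t\<^sup>2 * f y
        \<le> f x * (1 + 2 * t * (x \<bullet> y) + t\<^sup>2 * (y \<bullet> y))"
      by simp
    moreover have "2 * t * (y \<bullet> y) = 2 * t * (f x * (x \<bullet> y) - (M *v x) \<bullet> y)"
      by (subst y_def) (simp add: inner_diff_left)
    ultimately show "2 * t * (y \<bullet> y) + t\<^sup>2 * (f x * (y \<bullet> y) - f y) \<ge> 0"
      by (simp add: algebra_simps)
  qed simp
  then have "x \<in> eigenspace M (f x)"
    by (simp add: y_def eigenspace_def)
  with x show thesis
    by (intro that[of x]) auto
qed

text \<open>The orthogonal complement of all eigenvectors is invariant under \<open>M\<close>. Were
  it nonzero, it would contain an eigenvector, which would be orthogonal to itself.\<close>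

lemma symmetric_eigenvectors_span:
  fixes M :: "real^'n^'n"
  assumes sym: "transpose M = M"
  shows "span (\<Union>l. eigenspace M l) = UNIV"
proof (rule ccontr)
  define T where "T = {x. \<forall>l. \<forall>z \<in> eigenspace M l. z \<bullet> x = 0}"
  assume "span (\<Union>l. eigenspace M l) \<noteq> UNIV"
  then obtain a where a: "a \<noteq> 0" "\<And>x. x \<in> span (\<Union>l. eigenspace M l) \<Longrightarrow> a \<bullet> x = 0"
    using span_not_UNIV_orthogonal by metis
  then have "a \<in> T"
    by (auto simp: T_def inner_commute intro: span_base)
  have "subspace T"
    by (auto simp: T_def subspace_def inner_add_right)
  have "M *v x \<in> T" if "x \<in> T" for x
    using that by (auto simp: T_def eigenspace_def simp flip: symmetric_matrix_inner[OF sym])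
  then obtain l z where "z \<in> T" "z \<noteq> 0" "z \<in> eigenspace M l"
    using symmetric_invariant_subspace_eigenvector[OF sym \<open>subspace T\<close> _ \<open>a \<in> T\<close> \<open>a \<noteq> 0\<close>]
    by metis
  then have "z \<bullet> z = 0"
    unfolding T_def by blast
  with \<open>z \<noteq> 0\<close> show False
    by simp
qed

text \<open>Lets linear claims, such as identities and summability of series, be checked on
  eigenvectors without choosing an eigenbasis.\<close>

lemma symmetric_eigenvector_induct [consumes 1, case_names subspace eigenvector]:
  fixes M :: "real^'n^'n"
  assumes "transpose M = M" "subspace {x. P x}" "\<And>l z. z \<in> eigenspace M l \<Longrightarrow> P z"
  shows "P x"
proof -
  have "span (\<Union>l. eigenspace M l) \<subseteq> {x. P x}"
    using assms by (intro span_minimal) auto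
  then show ?thesis
    by (simp add: symmetric_eigenvectors_span[OF assms(1)] subset_iff)
qed

section \<open>Orthogonal projections and eigenprojections\<close>

lemma orthogonal_projection_eqI:
  assumes "subspace S" "y \<in> S" "\<And>z. z \<in> S \<Longrightarrow> orthogonal (x - y) z"
  shows "orthogonal_projection S x = y"
  unfolding orthogonal_projection_def
proof (rule the_equality)
  fix y' assume y': "y' \<in> S \<and> (\<forall>z\<in>S. orthogonal (x - y') z)"
  then have "y' - y \<in> S"
    using assms by (simp add: subspace_diff)
  then have "(x - y) \<bullet> (y' - y) = 0" "(x - y') \<bullet> (y' - y) = 0"
    using assms y' by (auto simp: orthogonal_def)
  then have "(y' - y) \<bullet> (y' - y) = 0"
    by (simp add: inner_diff_left)
  then show "y' = y"
    by simp
qed (use assms in auto)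

lemma
  fixes S :: "'a::euclidean_space set"
  assumes "subspace S"
  shows orthogonal_projection_mem: "orthogonal_projection S x \<in> S"
    and orthogonal_projection_inner: "z \<in> S \<Longrightarrow> orthogonal_projection S x \<bullet> z = x \<bullet> z"
proof -
  obtain y r where yr: "y \<in> span S" "\<And>w. w \<in> span S \<Longrightarrow> orthogonal r w" "x = y + r"
    using orthogonal_subspace_decomp_exists[of S x] by metis
  have "span S = S"
    using assms by (simp add: span_eq_iff)
  then have "orthogonal_projection S x = y"
    using yr by (intro orthogonal_projection_eqI assms) (simp_all del: span_eq_iff)
  then show "orthogonal_projection S x \<in> S"
    and "z \<in> S \<Longrightarrow> orthogonal_projection S x \<bullet> z = x \<bullet> z"
    using yr \<open>span S = S\<close> by (auto simp: inner_add_left orthogonal_def)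
qed

lemma linear_orthogonal_projection:
  fixes S :: "'a::euclidean_space set"
  assumes "subspace S"
  shows "linear (orthogonal_projection S)"
proof
  show "orthogonal_projection S (x + y) = orthogonal_projection S x + orthogonal_projection S y" for x y
    by (rule orthogonal_projection_eqI)
      (use assms in \<open>auto simp: subspace_add orthogonal_def inner_diff_left inner_add_left
        orthogonal_projection_mem orthogonal_projection_inner\<close>)
  show "orthogonal_projection S (c *\<^sub>R x) = c *\<^sub>R orthogonal_projection S x" for c x
    by (rule orthogonal_projection_eqI)
      (use assms in \<open>auto simp: subspace_scale orthogonal_def inner_diff_left
        orthogonal_projection_mem orthogonal_projection_inner\<close>)
qed

lemma eigenprojection_mult: "eigenprojection M l *v x = orthogonal_projection (eigenspace M l) x"
  unfolding eigenprojection_def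
  by (rule matrix_works)
    (simp add: linear_orthogonal_projection subspace_eigenspace linear_matrix_vector_mul_eq)

text \<open>A projection is determined by its inner products with the eigenspace. For standard basis
  vectors these are entries of eigenvectors, which eliminates projections from strong cospectrality
  and \<open>sigma_plus\<close>.\<close>

lemma eigenprojection_eq_iff:
  "eigenprojection M l *v x = eigenprojection M l *v y \<longleftrightarrow>
    (\<forall>z \<in> eigenspace M l. x \<bullet> z = y \<bullet> z)"
proof
  assume "eigenprojection M l *v x = eigenprojection M l *v y"
  then show "\<forall>z \<in> eigenspace M l. x \<bullet> z = y \<bullet> z"
    by (metis eigenprojection_mult orthogonal_projection_inner subspace_eigenspace)
next
  assume *: "\<forall>z \<in> eigenspace M l. x \<bullet> z = y \<bullet> z"
  show "eigenprojection M l *v x = eigenprojection M l *v y"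
    unfolding eigenprojection_mult
    by (rule orthogonal_projection_eqI)
      (use * in \<open>auto simp: subspace_eigenspace orthogonal_def inner_diff_left
        orthogonal_projection_mem orthogonal_projection_inner\<close>)
qed

lemma strongly_cospectral_iff:
  "strongly_cospectral M u v \<longleftrightarrow>
    (\<forall>l. (\<forall>z \<in> eigenspace M l. z $ u = z $ v) \<or> (\<forall>z \<in> eigenspace M l. z $ u = - z $ v))"
proof -
  have minus: "- (eigenprojection M l *v x) = eigenprojection M l *v (- x)" for l x
    by (simp add: linear_neg)
  \<comment> \<open>The right-hand side ranges over all real \<open>l\<close>; at a non-eigenvalue
    the eigenspace is zero and both alternatives hold trivially.\<close>
  have "z $ a = 0" if "l \<notin> eigenvalues M" "z \<in> eigenspace M l" for l z a
    using that by (auto simp: eigenvalues_def)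
  then show ?thesis
    unfolding strongly_cospectral_def minus eigenprojection_eq_iff
    by (auto simp: inner_axis')
qed

lemma sigma_plus_iff:
  "l \<in> sigma_plus M u v \<longleftrightarrow>
    (\<forall>z \<in> eigenspace M l. z $ u = z $ v) \<and> (\<exists>z \<in> eigenspace M l. z $ u \<noteq> 0)"
proof -
  have "eigenprojection M l *v axis u 1 = 0 \<longleftrightarrow> (\<forall>z \<in> eigenspace M l. z $ u = 0)"
    using eigenprojection_eq_iff[of M l "axis u 1" 0] by (simp add: inner_axis')
  moreover have "l \<in> eigenvalues M" if "z \<in> eigenspace M l" "z $ u \<noteq> 0" for z
    using that by (auto simp: eigenvalues_def intro!: bexI[of _ z])
  ultimately show ?thesis
    unfolding sigma_plus_def eigenprojection_eq_iff by (auto simp: inner_axis')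
qed

subsection \<open>Fractional revival in terms of eigenvectors\<close>

text \<open>The pairing is linear in the real vector, so agreement extends from eigenvectors to
  standard basis vectors, which read off the complex entries.\<close>

lemma symmetric_eigenvector_vec_eqI:
  fixes M :: "real^'n^'n" and y y' :: "complex^'n"
  assumes "transpose M = M"
    and "\<And>l z. z \<in> eigenspace M l \<Longrightarrow>
      (\<Sum>a\<in>UNIV. complex_of_real (z $ a) * y $ a) = (\<Sum>a\<in>UNIV. complex_of_real (z $ a) * y' $ a)"
  shows "y = y'"
proof -
  have *: "(\<Sum>a\<in>UNIV. complex_of_real (x $ a) * y $ a) = (\<Sum>a\<in>UNIV. complex_of_real (x $ a) * y' $ a)"
    for x :: "real^'n"
    using assms(1)
  proof (induction x rule: symmetric_eigenvector_induct)
    case subspace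
    show ?case
      by (auto simp: subspace_def algebra_simps sum.distrib simp flip: sum_distrib_left)
  qed (rule assms)
  show ?thesis
    using *[of "axis _ 1"] by (simp add: vec_eq_iff axis_def if_distrib if_distribR cong: if_cong)
qed

text \<open>By symmetry \<open>z\<close> is also a left eigenvector, so each left factor
  \<open>N\<close> of the power can be traded for the scalar \<open>c * l\<close>.\<close>

lemma matrix_power_eigenvector:
  fixes M :: "real^'n^'n" and c :: complex
  assumes sym: "transpose M = M" and z: "z \<in> eigenspace M l"
  defines "N \<equiv> map_matrix (\<lambda>x. c * complex_of_real x) M"
  shows "(\<Sum>a\<in>UNIV. complex_of_real (z $ a) * ((\<lambda>P. N ** P) ^^ k) (mat 1) $ a $ b) =
    (c * complex_of_real l) ^ k * complex_of_real (z $ b)"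
proof (induction k)
  case 0
  show ?case
    by (simp add: mat_def if_distrib cong: if_cong)
next
  case (Suc k)
  let ?P = "((\<lambda>P. N ** P) ^^ k) (mat 1)"
  have row: "(\<Sum>a\<in>UNIV. complex_of_real (z $ a) * N $ a $ d) = c * complex_of_real (l * z $ d)" for d
  proof -
    have "M $ a $ d = M $ d $ a" for a
      using sym by (metis transpose_def vec_lambda_beta)
    moreover have "(\<Sum>a\<in>UNIV. M $ d $ a * z $ a) = l * z $ d"
      using z by (simp add: eigenspace_def vec_eq_iff matrix_vector_mult_def)
    ultimately show ?thesis
      by (simp add: N_def map_matrix_def sum_distrib_left mult_ac flip: of_real_mult of_real_sum)
        (simp add: mult_ac flip: sum_distrib_left of_real_mult of_real_sum)
  qed
  have "(\<Sum>a\<in>UNIV. complex_of_real (z $ a) * ((\<lambda>P. N ** P) ^^ Suc k) (mat 1) $ a $ b) =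
      (\<Sum>a\<in>UNIV. \<Sum>d\<in>UNIV. complex_of_real (z $ a) * N $ a $ d * ?P $ d $ b)"
    by (simp add: matrix_matrix_mult_def sum_distrib_left mult_ac)
  also have "\<dots> = (\<Sum>d\<in>UNIV. (\<Sum>a\<in>UNIV. complex_of_real (z $ a) * N $ a $ d) * ?P $ d $ b)"
    by (subst sum.swap) (simp add: sum_distrib_right)
  also have "\<dots> = c * complex_of_real l * (\<Sum>d\<in>UNIV. complex_of_real (z $ d) * ?P $ d $ b)"
    by (simp add: row sum_distrib_left mult_ac)
  finally show ?case
    by (simp add: Suc.IH)
qed

lemma summable_vecI:
  fixes f :: "nat \<Rightarrow> 'a::real_normed_vector^'n"
  assumes "\<And>i. summable (\<lambda>k. f k $ i)"
  shows "summable f"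
proof -
  have "f sums (\<chi> i. \<Sum>k. f k $ i)"
    unfolding sums_def
    by (rule vec_tendstoI) (use assms[THEN summable_LIMSEQ] in \<open>simp add: lessThan_atLeast0\<close>)
  then show ?thesis
    by (rule sums_summable)
qed

text \<open>Pairing with an eigenvector collapses the matrix series to the scalar exponential
  series. Convergence of the matrix series has to be established first, entry by entry.\<close>

lemma transition_matrix_eigenvector:
  fixes M :: "real^'n^'n"
  assumes sym: "transpose M = M" and z: "z \<in> eigenspace M l"
  shows "(\<Sum>a\<in>UNIV. complex_of_real (z $ a) * transition_matrix M t $ a $ b) =
    cis (t * l) * complex_of_real (z $ b)"
proof -
  define N where "N = map_matrix (\<lambda>x. \<i> * complex_of_real t * complex_of_real x) M"
  define F where "F k = (1 / fact k) *\<^sub>R ((\<lambda>P. N ** P) ^^ k) (mat 1)" for k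
  have eig: "(\<lambda>k. \<Sum>a\<in>UNIV. complex_of_real (y $ a) * F k $ a $ b) sums
      (cis (t * m) * complex_of_real (y $ b))" if "y \<in> eigenspace M m" for y m b
  proof -
    have "(\<Sum>a\<in>UNIV. complex_of_real (y $ a) * F k $ a $ b) =
        ((\<i> * complex_of_real t * complex_of_real m) ^ k /\<^sub>R fact k) * complex_of_real (y $ b)" for k
      using matrix_power_eigenvector[OF sym that, where c = "\<i> * complex_of_real t" and k = k and b = b]
      by (simp add: F_def N_def divide_inverse flip: scaleR_sum_right)
    moreover have "cis (t * m) = exp (\<i> * complex_of_real t * complex_of_real m)"
      by (simp add: cis_conv_exp mult_ac)
    ultimately show ?thesis
      by (simp only: sums_mult2 exp_converges)
  qed
  \<comment> \<open>Pairings with eigenvectors converge by \<open>eig\<close>, and summability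
    survives linear combinations; standard basis vectors then give the entries of
    \<open>F\<close>.\<close>
  have "summable (\<lambda>k. \<Sum>a\<in>UNIV. complex_of_real (x $ a) * F k $ a $ b)" for x b
    using sym
  proof (induction x rule: symmetric_eigenvector_induct)
    case subspace
    show ?case
      by (auto simp: subspace_def distrib_right sum.distrib mult.assoc
          intro!: summable_add summable_mult simp flip: sum_distrib_left)
  next
    case eigenvector
    then show ?case
      using eig sums_summable by blast
  qed
  from this[of "axis _ 1"] have "summable (\<lambda>k. F k $ a $ b)" for a b
    by (simp add: axis_def if_distrib if_distribR cong: if_cong)
  then have "F sums transition_matrix M t"
    unfolding transition_matrix_def matrix_exp_def F_def[symmetric] N_def[symmetric]
    by (intro summable_sums summable_vecI)
  then have "(\<lambda>k. F k $ a $ b) sums (transition_matrix M t $ a $ b)" for a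
    by (intro sums_vec_nth)
  then have "(\<lambda>k. \<Sum>a\<in>UNIV. complex_of_real (z $ a) * F k $ a $ b) sums
      (\<Sum>a\<in>UNIV. complex_of_real (z $ a) * transition_matrix M t $ a $ b)"
    by (intro sums_sum sums_mult)
  then show ?thesis
    using eig[OF z] sums_unique2 by blast
qed

lemma fractional_revival_iff:
  fixes M :: "real^'n^'n"
  assumes sym: "transpose M = M"
  shows "fractional_revival M u v \<alpha> \<beta> \<tau> \<longleftrightarrow>
    (\<forall>l. \<forall>z \<in> eigenspace M l. cis (\<tau> * l) * complex_of_real (z $ u) =
      \<alpha> * complex_of_real (z $ u) + \<beta> * complex_of_real (z $ v))"
proof -
  let ?y = "transition_matrix M \<tau> *v axis u 1"
  let ?y' = "\<alpha> *s axis u 1 + \<beta> *s axis v 1"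
  have y: "(\<Sum>a\<in>UNIV. complex_of_real (z $ a) * ?y $ a) = cis (\<tau> * l) * complex_of_real (z $ u)"
    if "z \<in> eigenspace M l" for z l
    using transition_matrix_eigenvector[OF sym that]
    by (simp add: matrix_vector_mult_def axis_def if_distrib cong: if_cong)
  have y': "(\<Sum>a\<in>UNIV. complex_of_real (z $ a) * ?y' $ a) =
      \<alpha> * complex_of_real (z $ u) + \<beta> * complex_of_real (z $ v)" for z
    by (simp add: axis_def distrib_left sum.distrib mult_delta_right mult.commute)
  have "?y = ?y'" if "\<forall>l. \<forall>z \<in> eigenspace M l. cis (\<tau> * l) * complex_of_real (z $ u) =
      \<alpha> * complex_of_real (z $ u) + \<beta> * complex_of_real (z $ v)"
    using that by (intro symmetric_eigenvector_vec_eqI[OF sym]) (simp only: y y')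
  moreover have "cis (\<tau> * l) * complex_of_real (z $ u) =
      \<alpha> * complex_of_real (z $ u) + \<beta> * complex_of_real (z $ v)"
    if "?y = ?y'" "z \<in> eigenspace M l" for l z
    using y[OF that(2)] y'[of z] that(1) by simp
  ultimately show ?thesis
    unfolding fractional_revival_def by blast
qed

subsection \<open>Ratio condition and revival times\<close>

lemma coprime_fraction_times_int_iff:
  assumes "coprime n d" "d > 0" "x = real_of_int n / real_of_int d"
  shows "real_of_int m * x \<in> \<int> \<longleftrightarrow> d dvd m"
proof -
  have "real_of_int m * x = real_of_int (m * n) / real_of_int d"
    using assms by simp
  then have "real_of_int m * x \<in> \<int> \<longleftrightarrow> d dvd m * n"
    using assms(2) by (simp only: of_int_div_of_int_in_Ints_iff) auto
  also have "\<dots> \<longleftrightarrow> d dvd m"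
    using assms(1) by (simp add: coprime_dvd_mult_left_iff coprime_commute)
  finally show ?thesis .
qed

text \<open>The \<open>THE\<close> is witnessed by \<open>quotient_of\<close>, and unique because
  two reduced positive denominators of the same number divide each other.\<close>

lemma reduced_denominator_dvd_iff:
  assumes "x \<in> \<rat>"
  shows "reduced_denominator x dvd m \<longleftrightarrow> real_of_int m * x \<in> \<int>"
proof -
  obtain r where r: "x = of_rat r"
    using assms by (rule Rats_cases)
  obtain n d where nd: "quotient_of r = (n, d)"
    by fastforce
  have x: "d > 0" "coprime n d" "x = real_of_int n / real_of_int d"
    using nd quotient_of_denom_pos quotient_of_coprime quotient_of_div[OF nd]
    by (auto simp: r of_rat_divide)
  have "reduced_denominator x = d"
    unfolding reduced_denominator_def
  proof (rule the_equality)
    show "d > 0 \<and> (\<exists>n. coprime n d \<and> x = real_of_int n / real_of_int d)"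
      using x by blast
  next
    fix d' assume "d' > 0 \<and> (\<exists>n. coprime n d' \<and> x = real_of_int n / real_of_int d')"
    then obtain n' where x': "d' > 0" "coprime n' d'" "x = real_of_int n' / real_of_int d'"
      by blast
    have "real_of_int d * x \<in> \<int>"
      using x by simp
    moreover have "real_of_int d' * x \<in> \<int>"
      using x' by simp
    ultimately have "d' dvd d" "d dvd d'"
      using coprime_fraction_times_int_iff x x' by blast+
    then show "d' = d"
      using x(1) x'(1) by (simp add: zdvd_antisym_nonneg)
  qed
  then show ?thesis
    using coprime_fraction_times_int_iff x by blast
qed

lemma ratio_lcm_dvd_iff:
  assumes "\<And>l. l \<in> S \<Longrightarrow> (l1 - l) / (l1 - l2) \<in> \<rat>"
  shows "ratio_lcm S l1 l2 dvd m \<longleftrightarrow> (\<forall>l\<in>S. real_of_int m * ((l1 - l) / (l1 - l2)) \<in> \<int>)"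
proof -
  have "ratio_lcm S l1 l2 dvd m \<longleftrightarrow>
      (\<forall>l\<in>S - {l1}. real_of_int m * ((l1 - l) / (l1 - l2)) \<in> \<int>)"
    unfolding ratio_lcm_def using assms reduced_denominator_dvd_iff
    by (simp add: Lcm_dvd_iff)
  \<comment> \<open>At \<open>l = l1\<close> the ratio is 0, so restoring \<open>l1\<close> adds no
    condition.\<close>
  also have "\<dots> \<longleftrightarrow> (\<forall>l\<in>S. real_of_int m * ((l1 - l) / (l1 - l2)) \<in> \<int>)"
    by auto
  finally show ?thesis .
qed

lemma cis_eq_iff_Ints: "cis a = cis b \<longleftrightarrow> (a - b) / (2 * pi) \<in> \<int>"
proof -
  have "cis a = cis b \<longleftrightarrow> (\<exists>n::int. a = b + 2 * pi * of_int n)"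
    using sin_cos_eq_iff[of a b] by (auto simp: complex_eq_iff)
  also have "\<dots> \<longleftrightarrow> (\<exists>n::int. (a - b) / (2 * pi) = of_int n)"
    by (simp add: field_simps)
  finally show ?thesis
    by (auto simp: Ints_def)
qed

text \<open>
  Equality of \<open>cis (\<tau> * l)\<close> for all \<open>l \<in> S\<close> forces \<open>\<tau>\<close> to be an integer multiple of
  \<open>2 * pi * q / (l1 - l2)\<close>, so it suffices to look at that one time.
\<close>
lemma cis_separates_iff_ratio_lcm:
  assumes ratio: "ratio_condition S" and l: "l1 \<in> S" "l2 \<in> S" "l1 \<noteq> l2"
  shows "(\<exists>\<tau>. (\<forall>l\<in>S. cis (\<tau> * l) = cis (\<tau> * l1)) \<and> cis (\<tau> * \<theta>) \<noteq> cis (\<tau> * l1)) \<longleftrightarrow>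
    real_of_int (ratio_lcm S l1 l2) * ((l1 - \<theta>) / (l1 - l2)) \<notin> \<int>"
proof -
  have rat: "(l1 - l) / (l1 - l2) \<in> \<rat>" if "l \<in> S" for l
    using ratio l that unfolding ratio_condition_def by blast
  define q where "q = ratio_lcm S l1 l2"
  have q: "q dvd m \<longleftrightarrow> (\<forall>l\<in>S. real_of_int m * ((l1 - l) / (l1 - l2)) \<in> \<int>)" for m
    unfolding q_def using rat by (rule ratio_lcm_dvd_iff)
  \<comment> \<open>Here \<open>x\<close> measures the phase difference between \<open>l1\<close>
    and \<open>l2\<close> in full turns. Since \<open>l\<close> is not confined to \<open>S\<close>,
    this also applies to \<open>\<theta>\<close>.\<close>
  have cis: "cis (\<tau> * l) = cis (\<tau> * l1) \<longleftrightarrow> x * ((l1 - l) / (l1 - l2)) \<in> \<int>"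
    if "x = \<tau> * (l1 - l2) / (2 * pi)" for \<tau> l x
  proof -
    have "cis (\<tau> * l) = cis (\<tau> * l1) \<longleftrightarrow> (\<tau> * l1 - \<tau> * l) / (2 * pi) \<in> \<int>"
      using cis_eq_iff_Ints by metis
    also have "(\<tau> * l1 - \<tau> * l) / (2 * pi) = x * ((l1 - l) / (l1 - l2))"
      using l by (simp add: that field_simps)
    finally show ?thesis .
  qed
  show ?thesis
    unfolding q_def[symmetric]
  proof
    assume "\<exists>\<tau>. (\<forall>l\<in>S. cis (\<tau> * l) = cis (\<tau> * l1)) \<and> cis (\<tau> * \<theta>) \<noteq> cis (\<tau> * l1)"
    then obtain \<tau> where \<tau>: "\<And>l. l \<in> S \<Longrightarrow> cis (\<tau> * l) = cis (\<tau> * l1)" "cis (\<tau> * \<theta>) \<noteq> cis (\<tau> * l1)"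
      by blast
    define x where "x = \<tau> * (l1 - l2) / (2 * pi)"
    \<comment> \<open>At \<open>l = l2\<close> the ratio is 1.\<close>
    have "x \<in> \<int>"
      using \<tau>(1)[of l2] cis[OF x_def, of l2] l by simp
    then obtain m where m: "x = real_of_int m"
      by (auto elim: Ints_cases)
    have "q dvd m"
      using \<tau>(1) cis[OF x_def] q by (simp add: m)
    then obtain k where "m = q * k" ..
    then have "x * ((l1 - \<theta>) / (l1 - l2)) =
        real_of_int k * (real_of_int q * ((l1 - \<theta>) / (l1 - l2)))"
      by (simp add: m)
    \<comment> \<open>An integer value here would stay an integer after multiplication by
      \<open>k\<close>, so \<open>\<theta>\<close> would not be separated.\<close>
    then show "real_of_int q * ((l1 - \<theta>) / (l1 - l2)) \<notin> \<int>"
      using \<tau>(2) cis[OF x_def] by (metis Ints_mult Ints_of_int)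
  next
    assume not_int: "real_of_int q * ((l1 - \<theta>) / (l1 - l2)) \<notin> \<int>"
    \<comment> \<open>The time at which \<open>x\<close> equals \<open>q\<close>; the trivial
      \<open>q dvd q\<close> then says that all phases on \<open>S\<close> agree.\<close>
    define \<tau> where "\<tau> = 2 * pi * real_of_int q / (l1 - l2)"
    have x: "real_of_int q = \<tau> * (l1 - l2) / (2 * pi)"
      using l by (simp add: \<tau>_def)
    show "\<exists>\<tau>. (\<forall>l\<in>S. cis (\<tau> * l) = cis (\<tau> * l1)) \<and> cis (\<tau> * \<theta>) \<noteq> cis (\<tau> * l1)"
      using cis[OF x] q[of q] not_int by (intro exI[of _ \<tau>]) simp
  qed
qed

text \<open>Phase differences divided by \<open>2 * pi\<close> are integers, and the nonzero
  \<open>\<tau>\<close> cancels in their quotients.\<close>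

lemma ratio_condition_if_cis_eq:
  assumes S: "x \<in> S" "y \<in> S" "x \<noteq> y"
    and \<tau>: "\<And>l m. l \<in> S \<Longrightarrow> m \<in> S \<Longrightarrow> cis (\<tau> * l) = cis (\<tau> * m)" and "\<tau> \<noteq> 0"
  shows "ratio_condition S"
  unfolding ratio_condition_def
proof (intro conjI ballI impI)
  fix p q j k assume "p \<in> S" "q \<in> S" "j \<in> S" "k \<in> S" "j \<noteq> k"
  then have "(\<tau> * p - \<tau> * q) / (2 * pi) \<in> \<int>" "(\<tau> * j - \<tau> * k) / (2 * pi) \<in> \<int>"
    using \<tau> cis_eq_iff_Ints by blast+
  then have "((\<tau> * p - \<tau> * q) / (2 * pi)) / ((\<tau> * j - \<tau> * k) / (2 * pi)) \<in> \<rat>"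
    by (rule Rats_divide[OF subsetD[OF Ints_subset_Rats] subsetD[OF Ints_subset_Rats]])
  also have "((\<tau> * p - \<tau> * q) / (2 * pi)) / ((\<tau> * j - \<tau> * k) / (2 * pi)) = (p - q) / (j - k)"
    using \<open>\<tau> \<noteq> 0\<close> \<open>j \<noteq> k\<close> by (simp flip: right_diff_distrib)
  finally show "(p - q) / (j - k) \<in> \<rat>" .
qed (use S in blast)

subsection \<open>Twins\<close>

lemma twin_off_eigenvector_eq:
  fixes M :: "real^'n^'n"
  assumes sym: "transpose M = M" and d: "axis u 1 - axis v 1 \<in> eigenspace M \<theta>"
    and "z \<in> eigenspace M l" "l \<noteq> \<theta>"
  shows "z $ u = z $ v"
  using symmetric_eigenspaces_orthogonal[OF sym assms(3) d assms(4)]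
  by (simp add: inner_diff_right inner_axis)

text \<open>Away from \<open>\<theta>\<close> the plus alternative always holds; at
  \<open>\<theta>\<close> the eigenvector \<open>axis u 1 - axis v 1\<close> violates it, which
  leaves only the minus alternative.\<close>

lemma twin_strongly_cospectral_iff:
  fixes M :: "real^'n^'n"
  assumes sym: "transpose M = M" and "u \<noteq> v"
    and d: "axis u 1 - axis v 1 \<in> eigenspace M \<theta>"
  shows "strongly_cospectral M u v \<longleftrightarrow> (\<forall>z \<in> eigenspace M \<theta>. z $ u = - z $ v)"
proof -
  have "(axis u 1 - axis v 1 :: real^'n) $ u \<noteq> (axis u 1 - axis v 1) $ v"
    using \<open>u \<noteq> v\<close> by (simp add: axis_def)
  then have "\<not> (\<forall>z \<in> eigenspace M \<theta>. z $ u = z $ v)"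
    using d by blast
  then show ?thesis
    unfolding strongly_cospectral_iff using twin_off_eigenvector_eq[OF sym d] by metis
qed

text \<open>Revival reduces to \<open>\<alpha> + \<beta> = cis (\<tau> * l)\<close> for \<open>l \<in> S\<close> and \<open>\<alpha> - \<beta> = cis (\<tau> * \<theta>)\<close>.\<close>
lemma twin_proper_fractional_revival_iff:
  fixes M :: "real^'n^'n"
  assumes sym: "transpose M = M" and "u \<noteq> v"
    and d: "axis u 1 - axis v 1 \<in> eigenspace M \<theta>"
  defines "S \<equiv> sigma_plus M u v"
  shows "proper_fractional_revival M u v \<longleftrightarrow> strongly_cospectral M u v \<and>
    (\<exists>\<tau> c. (\<forall>l\<in>S. cis (\<tau> * l) = c) \<and> cis (\<tau> * \<theta>) \<noteq> c)"
proof -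
  have d_uv: "(axis u 1 - axis v 1 :: real^'n) $ u = 1" "(axis u 1 - axis v 1 :: real^'n) $ v = - 1"
    using \<open>u \<noteq> v\<close> by (auto simp: axis_def)
  note off = twin_off_eigenvector_eq[OF sym d]
  note sc = twin_strongly_cospectral_iff[OF assms(1-3)]
  show ?thesis
  proof
    assume "proper_fractional_revival M u v"
    then obtain \<tau> \<alpha> \<beta> where "\<beta> \<noteq> 0"
      and fr: "\<And>l z. z \<in> eigenspace M l \<Longrightarrow> cis (\<tau> * l) * complex_of_real (z $ u) =
        \<alpha> * complex_of_real (z $ u) + \<beta> * complex_of_real (z $ v)"
      unfolding proper_fractional_revival_def fractional_revival_iff[OF sym] by blast
    have \<theta>: "cis (\<tau> * \<theta>) = \<alpha> - \<beta>"
      using fr[OF d] unfolding d_uv by simp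
    have "z $ u = - z $ v" if "z \<in> eigenspace M \<theta>" for z
    proof -
      \<comment> \<open>Substituting \<open>\<alpha> - \<beta>\<close> for the phase at
        \<open>\<theta>\<close> cancels the terms with \<open>\<alpha>\<close>.\<close>
      have "\<beta> * complex_of_real (z $ u + z $ v) = 0"
        using fr[OF that] by (simp add: \<theta> algebra_simps)
      then have "z $ u + z $ v = 0"
        using \<open>\<beta> \<noteq> 0\<close> by (simp only: mult_eq_0_iff of_real_eq_0_iff) simp
      then show ?thesis
        by simp
    qed
    moreover have "cis (\<tau> * l) = \<alpha> + \<beta>" if l: "l \<in> S" for l
    proof -
      obtain z where z: "z \<in> eigenspace M l" "z $ u = z $ v" "z $ u \<noteq> 0"
        using l unfolding S_def sigma_plus_iff by blast
      have "(cis (\<tau> * l) - (\<alpha> + \<beta>)) * complex_of_real (z $ u) = 0"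
        using fr[OF z(1)] by (simp add: z(2) algebra_simps)
      then show ?thesis
        using z(3) by simp
    qed
    moreover have "cis (\<tau> * \<theta>) \<noteq> \<alpha> + \<beta>"
      using \<open>\<beta> \<noteq> 0\<close> by (simp add: \<theta>)
    ultimately show "strongly_cospectral M u v \<and>
        (\<exists>\<tau> c. (\<forall>l\<in>S. cis (\<tau> * l) = c) \<and> cis (\<tau> * \<theta>) \<noteq> c)"
      using sc by blast
  next
    assume "strongly_cospectral M u v \<and> (\<exists>\<tau> c. (\<forall>l\<in>S. cis (\<tau> * l) = c) \<and> cis (\<tau> * \<theta>) \<noteq> c)"
    then obtain \<tau> c where opp: "\<And>z. z \<in> eigenspace M \<theta> \<Longrightarrow> z $ u = - z $ v"
      and c: "\<And>l. l \<in> S \<Longrightarrow> cis (\<tau> * l) = c" "cis (\<tau> * \<theta>) \<noteq> c"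
      using sc by blast
    define \<alpha> \<beta> where "\<alpha> = (c + cis (\<tau> * \<theta>)) / 2" and "\<beta> = (c - cis (\<tau> * \<theta>)) / 2"
    have ab: "\<alpha> + \<beta> = c" "\<alpha> - \<beta> = cis (\<tau> * \<theta>)"
      by (auto simp: \<alpha>_def \<beta>_def field_simps)
    have "cis (\<tau> * l) * complex_of_real (z $ u) =
        \<alpha> * complex_of_real (z $ u) + \<beta> * complex_of_real (z $ v)" if z: "z \<in> eigenspace M l" for l z
    proof (cases "l = \<theta>")
      case True
      then have "z $ v = - z $ u"
        using opp z by simp
      then show ?thesis
        by (simp add: True algebra_simps flip: ab(2))
    next
      case False
      then have eq: "\<forall>y \<in> eigenspace M l. y $ u = y $ v"
        using off by blast
      \<comment> \<open>For \<open>l\<close> outside \<open>S\<close> both entries of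
        \<open>z\<close> vanish and the revival equation reads 0 = 0.\<close>
      have "z $ u = 0 \<or> l \<in> S"
        using eq z unfolding S_def sigma_plus_iff by blast
      then show ?thesis
        using c(1)[of l] eq z by (auto simp: algebra_simps simp flip: ab(1))
    qed
    moreover have "\<beta> \<noteq> 0"
      using c(2) by (simp add: \<beta>_def)
    ultimately show "proper_fractional_revival M u v"
      unfolding proper_fractional_revival_def fractional_revival_iff[OF sym] by blast
  qed
qed

text \<open>Every eigenvector is orthogonal to \<open>(M - l) (e\<^sub>u + e\<^sub>v)\<close>, which therefore vanishes.\<close>
lemma sigma_plus_subset_singleton_imp_eigenvector:
  fixes M :: "real^'n^'n"
  assumes sym: "transpose M = M" and "u \<noteq> v"
    and d: "axis u 1 - axis v 1 \<in> eigenspace M \<theta>"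
    and sc: "strongly_cospectral M u v" and sub: "sigma_plus M u v \<subseteq> {l}"
  shows "axis u 1 + axis v 1 \<in> eigenspace M l"
proof -
  define s :: "real^'n" where "s = axis u 1 + axis v 1"
  have "(M *v s - l *\<^sub>R s) \<bullet> x = 0" for x
    using sym
  proof (induction x rule: symmetric_eigenvector_induct)
    case subspace
    show ?case
      by (auto simp: subspace_def inner_add_right)
  next
    case (eigenvector m z)
    have "(M *v s - l *\<^sub>R s) \<bullet> z = (m - l) * (s \<bullet> z)"
      using eigenvector
      by (simp add: inner_diff_left symmetric_matrix_inner[OF sym] eigenspace_def algebra_simps)
    moreover have "s \<bullet> z = z $ u + z $ v"
      by (simp add: s_def inner_add_left inner_axis')
    \<comment> \<open>For \<open>m \<noteq> l\<close> the entries are opposite if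
      \<open>m = \<theta>\<close>; otherwise \<open>m\<close> lies outside
      \<open>sigma_plus M u v\<close> and both entries are zero.\<close>
    moreover have "m = l \<or> z $ u + z $ v = 0"
    proof (cases "m = \<theta>")
      case True
      then show ?thesis
        using twin_strongly_cospectral_iff[OF sym \<open>u \<noteq> v\<close> d] sc eigenvector by auto
    next
      case False
      then have "\<forall>y \<in> eigenspace M m. y $ u = y $ v"
        using twin_off_eigenvector_eq[OF sym d] by blast
      then show ?thesis
        using eigenvector sub sigma_plus_iff[of m M u v] by auto
    qed
    ultimately show ?case
      by auto
  qed
  then have "M *v s - l *\<^sub>R s = 0"
    using inner_eq_zero_iff by blast
  then show ?thesis
    by (simp add: s_def eigenspace_def)
qed

text \<open>Without such an edge everything reachable from \<open>u\<close> would stay in the pair,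
  leaving at most two vertices.\<close>

lemma connected_graph_pair_boundary:
  fixes w :: "'v::finite \<Rightarrow> 'v \<Rightarrow> real"
  assumes "connected_graph w" "CARD('v) \<ge> 3"
  obtains a x where "a \<in> {u, v}" "x \<notin> {u, v}" "w a x \<noteq> 0"
proof (rule ccontr)
  assume "\<not> thesis"
  then have closed: "w a x = 0" if "a \<in> {u, v}" "x \<notin> {u, v}" for a x
    using that \<open>\<And>a x. \<lbrakk>a \<in> {u, v}; x \<notin> {u, v}; w a x \<noteq> 0\<rbrakk> \<Longrightarrow> thesis\<close> by blast
  have "b \<in> {u, v}" for b
  proof -
    have "(\<lambda>x y. w x y \<noteq> 0)\<^sup>*\<^sup>* u b"
      using assms(1) by (simp add: connected_graph_def)
    then show ?thesis
      by (induction rule: rtranclp_induct) (use closed in blast)+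
  qed
  then have "(UNIV :: 'v set) \<subseteq> {u, v}"
    by blast
  then have "CARD('v) \<le> card {u, v}"
    by (intro card_mono) auto
  also have "\<dots> \<le> 2"
    by (simp add: card_insert_if)
  finally show False
    using assms(2) by simp
qed

section \<open>Weights, degrees and matrices of twins\<close>

lemma twins_weight_eq:
  assumes "twins w u v" "x \<notin> {u, v}"
  shows "w u x = w v x"
proof (cases "w u x = 0")
  \<comment> \<open>The definition compares weights only at neighbours; elsewhere equality of the
    neighbourhoods makes both weights zero.\<close>
  case True
  then have "x \<notin> nbhd w v - {u, v}"
    using assms unfolding twins_def nbhd_def by blast
  then show ?thesis
    using True assms(2) by (simp add: nbhd_def)
next
  case False
  then show ?thesis
    using assms unfolding twins_def nbhd_def by blast
qed

lemma twins_wdeg_eq: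
  fixes w :: "'v::finite \<Rightarrow> 'v \<Rightarrow> real"
  assumes "undirected w" "twins w u v"
  shows "wdeg w u = wdeg w v"
proof -
  have "u \<noteq> v" "w u u = w v v"
    using assms(2) by (auto simp: twins_def)
  have "(\<Sum>b\<in>UNIV - {u}. w u b) = w u v + (\<Sum>b\<in>UNIV - {u} - {v}. w u b)"
    using \<open>u \<noteq> v\<close> by (intro sum.remove) auto
  moreover have "(\<Sum>b\<in>UNIV - {v}. w v b) = w v u + (\<Sum>b\<in>UNIV - {v} - {u}. w v b)"
    using \<open>u \<noteq> v\<close> by (intro sum.remove) auto
  moreover have "(\<Sum>b\<in>UNIV - {u} - {v}. w u b) = (\<Sum>b\<in>UNIV - {v} - {u}. w v b)"
    using twins_weight_eq[OF assms(2)] by (intro sum.cong) auto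
  moreover have "w u v = w v u"
    using assms(1) by (simp add: undirected_def)
  ultimately show ?thesis
    using \<open>w u u = w v v\<close> by (simp add: wdeg_def)
qed

lemma axis_nth_if: "axis a y $ x = (if x = a then y else 0)"
  by (simp add: axis_def)

lemma matrix_vector_mult_axis_nth: "(M *v axis a 1) $ x = M $ x $ a"
  for M :: "'a::semiring_1^'n^'m"
  by (simp add: matrix_vector_mult_def axis_def if_distrib cong: if_cong)

lemma twin_columns_eigenvector:
  fixes M :: "real^'n^'n"
  assumes "M $ u $ u = M $ v $ v" "M $ u $ v = M $ v $ u"
    and "\<And>x. x \<notin> {u, v} \<Longrightarrow> M $ x $ u = M $ x $ v"
  shows "axis u 1 - axis v 1 \<in> eigenspace M (M $ u $ u - M $ u $ v)"
proof -
  have "(M *v (axis u 1 - axis v 1)) $ x =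
      ((M $ u $ u - M $ u $ v) *\<^sub>R (axis u 1 - axis v 1)) $ x" for x
    using assms
    by (cases "x = u"; cases "x = v")
      (auto simp: matrix_vector_mult_diff_distrib matrix_vector_mult_axis_nth axis_nth_if)
  then show ?thesis
    by (simp add: eigenspace_def vec_eq_iff)
qed

text \<open>Collects what the three choices of \<open>M\<close> have in common, so that the main
  argument needs no case distinction. Absolute values absorb the sign of the off-diagonal Laplacian
  entries.\<close>

lemma twins_matrix:
  fixes w :: "'v::finite \<Rightarrow> 'v \<Rightarrow> real"
  assumes "undirected w" "twins w u v"
    and "(M, \<theta>) \<in> {(adjacency_matrix w, w u u - w u v),
                    (laplacian_matrix w, wdeg w u - w u u + w u v),
                    (signless_laplacian_matrix w, wdeg w u + w u u - w u v)}"
  shows "transpose M = M"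
    and "axis u 1 - axis v 1 \<in> eigenspace M \<theta>"
    and "a \<noteq> x \<Longrightarrow> \<bar>M $ x $ a\<bar> = \<bar>w a x\<bar>"
    and "x \<notin> {u, v} \<Longrightarrow> M $ x $ u = M $ x $ v"
proof -
  note matrix_defs = adjacency_matrix_def laplacian_matrix_def signless_laplacian_matrix_def
    degree_matrix_def
  have sym: "w a b = w b a" for a b
    using assms(1) by (simp add: undirected_def)
  have tw: "u \<noteq> v" "w u u = w v v" "wdeg w u = wdeg w v"
    using assms twins_wdeg_eq by (auto simp: twins_def)
  show "transpose M = M"
    using assms(3) sym by (auto simp: matrix_defs transpose_def vec_eq_iff)
  show "a \<noteq> x \<Longrightarrow> \<bar>M $ x $ a\<bar> = \<bar>w a x\<bar>"
    using assms(3) sym[of a x] by (auto simp: matrix_defs)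
  have *: "M $ x $ u = M $ x $ v" if "x \<notin> {u, v}" for x
    using assms(3) that twins_weight_eq[OF assms(2) that] sym by (auto simp: matrix_defs)
  then show "x \<notin> {u, v} \<Longrightarrow> M $ x $ u = M $ x $ v"
    by blast
  have "M $ u $ u = M $ v $ v" "M $ u $ v = M $ v $ u" "\<theta> = M $ u $ u - M $ u $ v"
    using assms(3) tw sym by (auto simp: matrix_defs)
  then show "axis u 1 - axis v 1 \<in> eigenspace M \<theta>"
    using twin_columns_eigenvector[of M u v] * by simp
qed

theorem theorem3p6:
  fixes w :: "'v::finite \<Rightarrow> 'v \<Rightarrow> real"
    and M :: "real^'v^'v"
    and \<theta> :: real
    and u v :: 'v
  assumes "undirected w"
    and "connected_graph w"
    and "CARD('v) \<ge> 3"
    and "twins w u v"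
    and "(M, \<theta>) \<in> {(adjacency_matrix w, w u u - w u v),
                    (laplacian_matrix w, wdeg w u - w u u + w u v),
                    (signless_laplacian_matrix w, wdeg w u + w u u - w u v)}"
  shows "proper_fractional_revival M u v \<longleftrightarrow>
    strongly_cospectral M u v \<and>
    ratio_condition (sigma_plus M u v) \<and>
    (\<exists>l1 \<in> sigma_plus M u v. \<exists>l2 \<in> sigma_plus M u v. l1 > l2 \<and>
       real_of_int (ratio_lcm (sigma_plus M u v) l1 l2) * ((l1 - \<theta>) / (l1 - l2)) \<notin> \<int>)"
proof -
  define S where "S = sigma_plus M u v"
  note M = twins_matrix[OF assms(1,4,5)]
  have "u \<noteq> v"
    using assms(4) by (simp add: twins_def)
  note pfr = twin_proper_fractional_revival_iff[OF M(1) \<open>u \<noteq> v\<close> M(2), folded S_def]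
  have two: "\<exists>l1\<in>S. \<exists>l2\<in>S. l1 > l2" if sc: "strongly_cospectral M u v"
  proof (rule ccontr)
    assume *: "\<not> (\<exists>l1\<in>S. \<exists>l2\<in>S. l1 > l2)"
    \<comment> \<open>Containment in a singleton also covers an empty \<open>S\<close>.\<close>
    then obtain l where "S \<subseteq> {l}"
      by (metis linorder_neqE singleton_iff subsetI)
    then have s: "axis u 1 + axis v 1 \<in> eigenspace M l"
      using sigma_plus_subset_singleton_imp_eigenvector[OF M(1) \<open>u \<noteq> v\<close> M(2) sc] S_def by simp
    obtain a x where x: "a \<in> {u, v}" "x \<notin> {u, v}" "w a x \<noteq> 0"
      using connected_graph_pair_boundary[OF assms(2,3)] .
    have "(M *v (axis u 1 + axis v 1)) $ x = (l *\<^sub>R (axis u 1 + axis v 1)) $ x"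
      using s by (simp add: eigenspace_def)
    \<comment> \<open>The vector \<open>axis u 1 + axis v 1\<close> is zero at \<open>x\<close>. The
      two matrix entries are equal by the twin property and sum to zero, so both vanish, against the
      edge from \<open>a\<close> to \<open>x\<close>.\<close>
    then have "M $ x $ u + M $ x $ v = 0"
      using x(2)
      by (simp add: matrix_vector_right_distrib matrix_vector_mult_axis_nth axis_nth_if)
    then have "M $ x $ a = 0"
      using x(1) M(4)[OF x(2)] by auto
    then show False
      using M(3)[of a x] x by auto
  qed
  have "proper_fractional_revival M u v \<longleftrightarrow> strongly_cospectral M u v \<and> ratio_condition S \<and>
    (\<exists>l1\<in>S. \<exists>l2\<in>S. l1 > l2 \<and>
      real_of_int (ratio_lcm S l1 l2) * ((l1 - \<theta>) / (l1 - l2)) \<notin> \<int>)"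
  proof
    assume "proper_fractional_revival M u v"
    then obtain \<tau> c where sc: "strongly_cospectral M u v"
      and c: "\<And>l. l \<in> S \<Longrightarrow> cis (\<tau> * l) = c" "cis (\<tau> * \<theta>) \<noteq> c"
      using pfr by blast
    \<comment> \<open>Any such pair serves, because the criterion by \<open>ratio_lcm\<close> holds
      for all distinct \<open>l1\<close> and \<open>l2\<close> in \<open>S\<close>.\<close>
    obtain l1 l2 where l: "l1 \<in> S" "l2 \<in> S" "l1 > l2"
      using two[OF sc] by blast
    \<comment> \<open>At time 0 every phase is 1, so \<open>\<theta>\<close> could not be separated
      from \<open>l1\<close>.\<close>
    have "\<tau> \<noteq> 0"
      using c l(1) by force
    then have ratio: "ratio_condition S"
      using l c by (intro ratio_condition_if_cis_eq[of l1 S l2 \<tau>]) auto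
    moreover have "real_of_int (ratio_lcm S l1 l2) * ((l1 - \<theta>) / (l1 - l2)) \<notin> \<int>"
      using cis_separates_iff_ratio_lcm[OF ratio l(1,2), of \<theta>] l c by auto
    ultimately show "strongly_cospectral M u v \<and> ratio_condition S \<and>
        (\<exists>l1\<in>S. \<exists>l2\<in>S. l1 > l2 \<and>
          real_of_int (ratio_lcm S l1 l2) * ((l1 - \<theta>) / (l1 - l2)) \<notin> \<int>)"
      using sc l by blast
  next
    assume rhs: "strongly_cospectral M u v \<and> ratio_condition S \<and>
        (\<exists>l1\<in>S. \<exists>l2\<in>S. l1 > l2 \<and>
          real_of_int (ratio_lcm S l1 l2) * ((l1 - \<theta>) / (l1 - l2)) \<notin> \<int>)"
    then obtain l1 l2 where "l1 \<in> S" "l2 \<in> S" "l1 \<noteq> l2"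
      "real_of_int (ratio_lcm S l1 l2) * ((l1 - \<theta>) / (l1 - l2)) \<notin> \<int>"
      by auto
    then show "proper_fractional_revival M u v"
      using pfr rhs cis_separates_iff_ratio_lcm[of S l1 l2 \<theta>] by blast
  qed
  then show ?thesis
    unfolding S_def .
qed

end
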